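(* Let $A\in\mathbb{R}^{m\times n}$ with $i$-th row $a_i^T$, $b\in\mathbb{R}^m$, and consider the affine-ReLU function $F(x)=\mathrm{relu}(Ax+b)$ (ReLU applied entrywise, $\mathrm{relu}(t)=\max(0,t)$). Let $x_0\in\mathbb{R}^n$, $\epsilon\ge0$, $D=\mathrm{diag}(d_1,\dots,d_n)$ with $d_j\in\{0,1\}$, and $\mathcal{X}=\{x_0+D\Delta x:\ \|\Delta x\|\le\epsilon\}$. Let $y_0=Ax_0+b$, $\mathcal{Y}=\{Ax+b:x\in\mathcal{X}\}$, $\mathcal{Y}_i=\{y_i: y\in\mathcal{Y}\}$, and $\bar y_i=\max\mathcal{Y}_i$. Define $$r_i=\begin{cases}0,& \mathcal{Y}_i=\{y_{0,i}\},\\[2pt] \dfrac{\mathrm{relu}(\bar y_i)-\mathrm{relu}(y_{0,i})}{\bar y_i-y_{0,i}},&\text{otherwise},\end{cases}\qquad R=\mathrm{diag}(r_1,\dots,r_m).$$ Then the local Lipschitz constant of $F$ satisfies $$L(x_0,\mathcal{X})\le\|RAD\|,$$ where $\|RAD\|$ is the spectral norm.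
   Context: $\|\cdot\|$ is the Euclidean norm on vectors and the induced operator (spectral) norm on matrices. For $F:\mathbb{R}^n\to\mathbb{R}^m$, $x_0\in\mathbb{R}^n$ and $\mathcal{X}\subseteq\mathbb{R}^n$, the local Lipschitz constant is $L(x_0,\mathcal{X})=\sup_{x\in\mathcal{X},\,x\neq x_0}\frac{\|F(x)-F(x_0)\|}{\|x-x_0\|}$, with the convention that the supremum over an empty set is $0$. $y_i, y_{0,i}$ denote $i$-th entries. *)

theory Defs
  imports "HOL-Analysis.Analysis"
begin

definition relu :: "real \<Rightarrow> real" where
  "relu t = max 0 t"

text \<open>Diagonal matrix with given diagonal entries.\<close>
definition diag_mat :: "real ^ 'n \<Rightarrow> real ^ 'n ^ 'n" where
  "diag_mat d = (\<chi> i j. if i = j then d $ i else 0)"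

text \<open>Local Lipschitz constant, valued in the extended reals so that an
  unbounded supremum is +infinity; supremum over the empty set is 0.\<close>
definition local_lip ::
  "('a::real_normed_vector \<Rightarrow> 'b::real_normed_vector) \<Rightarrow> 'a \<Rightarrow> 'a set \<Rightarrow> ereal" where
  "local_lip F x0 X =
     (if X - {x0} = {} then 0
      else (SUP x\<in>X - {x0}. ereal (norm (F x - F x0) / norm (x - x0))))"

text \<open>Spectral (operator 2-)norm of a matrix.\<close>
definition spec_norm :: "real ^ 'n ^ 'm \<Rightarrow> real" where
  "spec_norm M = onorm (\<lambda>v. M *v v)"

end

theory Submission imports Defs begin

text \<open>For \<open>x = x0 + D \<Delta>x\<close> the \<open>i\<close>-th entry of \<open>Ax + b\<close> is \<open>y0\<^sub>i + t\<close> with \<open>t = (AD\<Delta>x)\<^sub>i\<close>. Replacing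
  \<open>\<Delta>x\<close> by \<open>-\<Delta>x\<close> shows that the range \<open>\<Y>\<^sub>i\<close> is symmetric about \<open>y0\<^sub>i\<close>, so \<open>|t| \<le> ybar\<^sub>i - y0\<^sub>i\<close>.
  Since relu is convex, its increments from \<open>y0\<^sub>i\<close> over \<open>[y0\<^sub>i - |t|, y0\<^sub>i + |t|]\<close> are at most the
  secant slope \<open>r\<^sub>i\<close> over \<open>[y0\<^sub>i, ybar\<^sub>i]\<close> times \<open>|t|\<close>. Hence \<open>|F x - F x0|\<close> is dominated entrywise by
  \<open>|RAD\<Delta>x|\<close>, and \<open>RAD\<Delta>x = RAD(x - x0)\<close> because \<open>D\<close> is idempotent.\<close>

lemma relu_secant_slope_nonneg: "0 \<le> (relu a - relu b) / (a - b)"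
proof (cases "a \<le> b")
  case True
  then have "relu a \<le> relu b" by (simp add: relu_def)
  with True show ?thesis by (simp add: zero_le_divide_iff)
next
  case False
  then have "relu b \<le> relu a" by (simp add: relu_def)
  with False show ?thesis by (simp add: zero_le_divide_iff)
qed

lemma relu_increment_le_secant:
  fixes c yb t :: real
  assumes "c < yb" and "\<bar>t - c\<bar> \<le> yb - c"
  shows "\<bar>relu t - relu c\<bar> \<le> (relu yb - relu c) / (yb - c) * \<bar>t - c\<bar>"
proof (cases "0 \<le> c")
  case True
  then show ?thesis using assms by (simp add: relu_def max_def)
next
  case c_neg: False
  show ?thesis
  proof (cases "t \<le> 0")
    case True
    then have "relu t = relu c" using c_neg by (simp add: relu_def)
    then show ?thesis
      using mult_nonneg_nonneg[OF relu_secant_slope_nonneg[of yb c] abs_ge_zero[of "t - c"]] by simp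
  next
    case t_pos: False
    have "t * (yb - c) \<le> yb * (t - c)"
      using mult_right_mono[of t yb "- c"] assms c_neg by (simp add: algebra_simps)
    then show ?thesis using assms c_neg t_pos by (simp add: relu_def max_def field_simps)
  qed
qed

lemma abs_le_Sup_symmetric_range:
  fixes f :: "'a::real_normed_vector \<Rightarrow> real" and c :: real
  assumes f: "bounded_linear f" and u: "norm u \<le> \<epsilon>"
  defines "S \<equiv> {c + f v | v. norm v \<le> \<epsilon>}"
  shows "\<bar>f u\<bar> \<le> Sup S - c"
proof -
  obtain K where K: "\<And>v. norm (f v) \<le> norm v * K" and "K > 0"
    using bounded_linear.pos_bounded[OF f] by blast
  have "bdd_above S"
  proof (rule bdd_aboveI)
    fix z assume "z \<in> S"
    then obtain v where "norm v \<le> \<epsilon>" "z = c + f v" unfolding S_def by blast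
    moreover have "norm v * K \<le> \<epsilon> * K" using \<open>norm v \<le> \<epsilon>\<close> \<open>K > 0\<close> by simp
    ultimately show "z \<le> c + \<epsilon> * K" using K[of v] by simp
  qed
  moreover have "c + f u \<in> S" using u unfolding S_def by blast
  moreover have "c - f u = c + f (- u)" and "norm (- u) \<le> \<epsilon>"
    using u linear_neg[OF bounded_linear.linear[OF f], of u] by simp_all
  then have "c - f u \<in> S" unfolding S_def by blast
  ultimately have "c + f u \<le> Sup S" and "c - f u \<le> Sup S" by (simp_all add: cSup_upper)
  then show ?thesis by linarith
qed

lemma relu_increment_le_range_slope:
  fixes f :: "'a::real_normed_vector \<Rightarrow> real" and c :: real
  assumes f: "bounded_linear f" and u: "norm u \<le> \<epsilon>"
  defines "S \<equiv> {c + f v | v. norm v \<le> \<epsilon>}"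
  shows "\<bar>relu (c + f u) - relu c\<bar>
    \<le> (if S = {c} then 0 else (relu (Sup S) - relu c) / (Sup S - c)) * \<bar>f u\<bar>"
proof (cases "S = {c}")
  case True
  moreover have "c + f u \<in> S" using u unfolding S_def by blast
  ultimately show ?thesis by simp
next
  case False
  have "norm (0 :: 'a) \<le> \<epsilon>" using order_trans[OF norm_ge_zero u] by simp
  then have "c \<in> S" unfolding S_def using linear_0[OF bounded_linear.linear[OF f]] by force
  with False obtain z where "z \<in> S" "z \<noteq> c" by blast
  then obtain v where v: "norm v \<le> \<epsilon>" "f v \<noteq> 0" unfolding S_def by auto
  have "c < Sup S"
    using abs_le_Sup_symmetric_range[OF f v(1), of c] v(2) unfolding S_def by linarith
  moreover have "\<bar>(c + f u) - c\<bar> \<le> Sup S - c"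
    using abs_le_Sup_symmetric_range[OF f u, of c] unfolding S_def by simp
  ultimately have "\<bar>relu (c + f u) - relu c\<bar> \<le> (relu (Sup S) - relu c) / (Sup S - c) * \<bar>f u\<bar>"
    using relu_increment_le_secant[of c "Sup S" "c + f u"] by simp
  with False show ?thesis by simp
qed

lemma diag_mat_mult_vec_nth: "(diag_mat d *v v) $ i = d $ i * v $ i"
  unfolding diag_mat_def matrix_vector_mult_def by (simp add: if_distrib if_distribR cong: if_cong)

lemma norm_relu_increment_le_range_slopes:
  fixes L :: "'a::real_normed_vector \<Rightarrow> real ^ 'm" and c :: "real ^ 'm"
  assumes L: "bounded_linear L" and u: "norm u \<le> \<epsilon>"
  defines "S \<equiv> \<lambda>i. {c $ i + L v $ i | v. norm v \<le> \<epsilon>}"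
  shows "norm ((\<chi> i. relu (c $ i + L u $ i)) - (\<chi> i. relu (c $ i)))
    \<le> norm (diag_mat (\<chi> i. if S i = {c $ i} then 0
          else (relu (Sup (S i)) - relu (c $ i)) / (Sup (S i) - c $ i)) *v L u)"
proof (rule norm_le_componentwise_cart)
  fix i
  have "bounded_linear (\<lambda>v. L v $ i)"
    by (rule bounded_linear_compose[OF bounded_linear_vec_nth L])
  from relu_increment_le_range_slope[OF this u, of "c $ i"]
  have "\<bar>relu (c $ i + L u $ i) - relu (c $ i)\<bar>
      \<le> (if S i = {c $ i} then 0 else (relu (Sup (S i)) - relu (c $ i)) / (Sup (S i) - c $ i))
        * \<bar>L u $ i\<bar>"
    unfolding S_def by simp
  then show "norm (((\<chi> i. relu (c $ i + L u $ i)) - (\<chi> i. relu (c $ i))) $ i)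
      \<le> norm ((diag_mat (\<chi> i. if S i = {c $ i} then 0
          else (relu (Sup (S i)) - relu (c $ i)) / (Sup (S i) - c $ i)) *v L u) $ i)"
    using relu_secant_slope_nonneg by (simp add: diag_mat_mult_vec_nth abs_mult)
qed

lemma diag_mat_idempotent:
  assumes "\<forall>j. d $ j \<in> {0, 1}"
  shows "diag_mat d *v (diag_mat d *v v) = diag_mat d *v v"
  using assms by (auto simp: vec_eq_iff diag_mat_mult_vec_nth)

lemma spec_norm_nonneg: "0 \<le> spec_norm M"
  unfolding spec_norm_def by (simp add: onorm_pos_le)

lemma norm_mult_vec_le_spec_norm: "norm (M *v v) \<le> spec_norm M * norm v"
  unfolding spec_norm_def by (simp add: onorm)

lemma local_lip_le:
  assumes "0 \<le> C" and "\<And>x. x \<in> X \<Longrightarrow> x \<noteq> x0 \<Longrightarrow> norm (F x - F x0) \<le> C * norm (x - x0)"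
  shows "local_lip F x0 X \<le> ereal C"
proof -
  have "norm (F x - F x0) / norm (x - x0) \<le> C" if "x \<in> X - {x0}" for x
    using that assms(2)[of x] by (simp add: divide_le_eq)
  then have "(SUP x\<in>X - {x0}. ereal (norm (F x - F x0) / norm (x - x0))) \<le> ereal C"
    by (intro SUP_least) auto
  then show ?thesis
    unfolding local_lip_def using assms(1) by simp
qed

theorem theorem2:
  fixes A :: "real ^ 'n ^ 'm" and b :: "real ^ 'm" and x0 :: "real ^ 'n"
    and \<epsilon> :: real and d :: "real ^ 'n"
    and F :: "real ^ 'n \<Rightarrow> real ^ 'm"
    and X :: "(real ^ 'n) set" and Y :: "(real ^ 'm) set"
    and y0 :: "real ^ 'm" and ybar r :: "'m \<Rightarrow> real"
  assumes F_def: "F = (\<lambda>x. \<chi> i. relu ((A *v x + b) $ i))"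
    and eps: "\<epsilon> \<ge> 0"
    and d01: "\<forall>j. d $ j \<in> {0, 1}"
    and X_def: "X = {x0 + diag_mat d *v dx | dx. norm dx \<le> \<epsilon>}"
    and y0_def: "y0 = A *v x0 + b"
    and Y_def: "Y = {A *v x + b | x. x \<in> X}"
    and ybar_def: "\<forall>i. ybar i = Sup {y $ i | y. y \<in> Y}"
    and r_def: "\<forall>i. r i = (if {y $ i | y. y \<in> Y} = {y0 $ i} then 0
                  else (relu (ybar i) - relu (y0 $ i)) / (ybar i - y0 $ i))"
  shows "local_lip F x0 X \<le> ereal (spec_norm (diag_mat (\<chi> i. r i) ** A ** diag_mat d))"
proof (rule local_lip_le[OF spec_norm_nonneg])
  define L where "L v = A *v (diag_mat d *v v)" for v
  let ?S = "\<lambda>i. {y0 $ i + L v $ i | v. norm v \<le> \<epsilon>}"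
  have affine: "A *v (x0 + diag_mat d *v v) + b = y0 + L v" for v
    by (simp add: L_def y0_def matrix_vector_right_distrib algebra_simps)
  have "{y $ i | y. y \<in> Y} = ?S i" for i
    unfolding Y_def X_def by (auto simp: affine) (metis affine vector_add_component)
  then have r_eq: "(\<chi> i. r i) = (\<chi> i. if ?S i = {y0 $ i} then 0
      else (relu (Sup (?S i)) - relu (y0 $ i)) / (Sup (?S i) - y0 $ i))"
    using r_def ybar_def by (simp add: vec_eq_iff)
  have L: "bounded_linear L"
    unfolding L_def by (simp add: bounded_linear_compose[OF matrix_vector_mul_bounded_linear])
  fix x assume "x \<in> X"
  then obtain v where v: "norm v \<le> \<epsilon>" "x = x0 + diag_mat d *v v" unfolding X_def by blast
  have "norm (F x - F x0) = norm ((\<chi> i. relu (y0 $ i + L v $ i)) - (\<chi> i. relu (y0 $ i)))"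
    unfolding F_def v(2) affine by (simp flip: y0_def)
  also have "\<dots> \<le> norm (diag_mat (\<chi> i. r i) *v L v)"
    unfolding r_eq by (rule norm_relu_increment_le_range_slopes[OF L v(1)])
  also have "diag_mat (\<chi> i. r i) *v L v = (diag_mat (\<chi> i. r i) ** A ** diag_mat d) *v (x - x0)"
    by (simp add: L_def v(2) diag_mat_idempotent[OF d01] flip: matrix_vector_mul_assoc)
  also have "norm \<dots> \<le> spec_norm (diag_mat (\<chi> i. r i) ** A ** diag_mat d) * norm (x - x0)"
    by (rule norm_mult_vec_le_spec_norm)
  finally show "norm (F x - F x0) \<le> spec_norm (diag_mat (\<chi> i. r i) ** A ** diag_mat d) * norm (x - x0)" .
qed

end
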